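(* Fix a connected graph $H$ on $\zeta\ge 2$ vertices, $\theta>0$ and $\beta_0\in\mathbb{R}$. With $s=s_n$ and $A=A_n$, consider testing $\mathcal{H}_0:\bm\beta=\beta_0\mathbf 1$ against $\mathcal{H}_1:\bm\beta\in\Xi(s,A)$ from one observation $G\sim\mathbb{P}_{n,\theta,\bm\beta}$ of the degree corrected ERGM with subgraph $H$. If $sA\to\infty$, then for any sequence $L_n$ such that $n\ll L_n\ll nsA$, the conditionally centered sum of degrees test $$T_n(G)=\begin{cases}1 & \text{if } \sum_{e\in\mathcal{E}}\Big[G_e-\mathbb{E}_{n,\theta,\beta_0\mathbf 1}\big(G_e\,\big|\,G_f:f\in\mathcal{E},f\ne e\big)\Big]>L_n,\\ 0&\text{otherwise}\end{cases}$$ is asymptotically powerful, i.e. $$\lim_{n\to\infty}\Big[\mathbb{P}_{n,\theta,\beta_0\mathbf 1}(T_n(G)=1)+\sup_{\bm\beta\in\Xi(s,A)}\mathbb{P}_{n,\theta,\bm\beta}(T_n(G)=0)\Big]=0.$$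
   Context: $\mathcal{G}_n$ is the set of simple labeled graphs on $[n]=\{1,\dots,n\}$; a graph $G$ is identified with its $\{0,1\}$ symmetric adjacency matrix, $G_{ii}=0$. $\mathcal{E}=\{(i,j):1\le i<j\le n\}$, and for $e=(i,j)\in\mathcal{E}$, $G_e=G_{ij}$. Degrees: $d_i=\sum_{j}G_{ij}$. For a fixed connected graph $H$ with vertex set $[\zeta]$, $N(H,G)=\sum_{\iota}\prod_{(i,j)\in E(H)}G_{\iota(i),\iota(j)}$, where the sum is over all injective maps $\iota:[\zeta]\to[n]$ and $E(H)$ is the edge set of $H$ (each edge taken once). The degree corrected ERGM is the probability mass function on $\mathcal{G}_n$ $$\mathbb{P}_{n,\theta,\bm\beta}(G)=\frac{1}{Z_n(\bm\beta,\theta,H)}\exp\Big\{\frac{\theta}{n^{\zeta-2}}N(H,G)+\sum_{i=1}^n\beta_id_i\Big\},\quad \bm\beta\in\mathbb{R}^n,$$ with $Z_n$ the normalizing constant and $\mathbb{E}_{n,\theta,\bm\beta}$ the expectation. $\mathbf 1$ is the all-ones vector. The parameters $\theta,\beta_0$ are known. The alternative is $$\Xi(s,A)=\{\bm\beta=\beta_0\mathbf 1+\bm\mu:\ |\mathrm{supp}(\bm\mu)|\ge s,\ \min_{i\in\mathrm{supp}(\bm\mu)}\mu_i\ge A\}.$$ $a_n\ll b_n$ means $a_n/b_n\to0$.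
   Formalization: The condition L_n ≪ ns is added to n ≪ L_n ≪ nsA; it is automatic when A is bounded, and without it the claim fails (H an edge, s = A = n, L_n = n^{5/2}: the statistic never exceeds n²/2, so the test never rejects). *)

theory Defs
  imports "HOL-Probability.Probability"
begin

text \<open>
  A simple labelled graph on \<open>{1..n}\<close> is its symmetric 0/1 adjacency matrix with zero diagonal,
  stored as a function on all of \<^typ>\<open>nat\<close> that vanishes outside \<open>{1..n}\<close>, so that graphs
  correspond one to one to elements of \<open>graphs n\<close>.
\<close>

type_synonym adj = "nat \<Rightarrow> nat \<Rightarrow> real"

definition graphs :: "nat \<Rightarrow> adj set" where
  "graphs n = {G. (\<forall>i j. G i j \<in> {0, 1}) \<and> (\<forall>i j. G i j = G j i) \<and> (\<forall>i. G i i = 0) \<and>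
                  (\<forall>i j. i \<notin> {1..n} \<or> j \<notin> {1..n} \<longrightarrow> G i j = 0)}"

definition pairs :: "nat \<Rightarrow> (nat \<times> nat) set" where
  "pairs n = {(i, j). 1 \<le> i \<and> i < j \<and> j \<le> n}"

definition edges :: "nat \<Rightarrow> adj \<Rightarrow> (nat \<times> nat) set" where
  "edges n G = {(i, j) \<in> pairs n. G i j = 1}"

definition connected_graph :: "nat \<Rightarrow> adj \<Rightarrow> bool" where
  "connected_graph n G \<longleftrightarrow> (\<forall>u \<in> {1..n}. \<forall>v \<in> {1..n}. (u, v) \<in> {(i, j). G i j = 1}\<^sup>*)"

definition deg :: "nat \<Rightarrow> adj \<Rightarrow> nat \<Rightarrow> real" where
  "deg n G i = (\<Sum>j = 1..n. G i j)"

text \<open>\<open>inj_count \<zeta> H n G\<close> is \<open>N(H, G)\<close> for \<open>H\<close> on \<open>{1..\<zeta>}\<close> and \<open>G\<close> on \<open>{1..n}\<close>.\<close>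

definition inj_count :: "nat \<Rightarrow> adj \<Rightarrow> nat \<Rightarrow> adj \<Rightarrow> real" where
  "inj_count \<zeta> H n G =
     (\<Sum>\<iota> \<in> {\<iota> \<in> {1..\<zeta>} \<rightarrow>\<^sub>E {1..n}. inj_on \<iota> {1..\<zeta>}}. \<Prod>(i, j) \<in> edges \<zeta> H. G (\<iota> i) (\<iota> j))"

text \<open>
  A parameter vector \<open>\<beta> \<in> \<real>\<^sup>n\<close> is a function on \<^typ>\<open>nat\<close> of which only the values on
  \<open>{1..n}\<close> are used. The exponent \<open>\<zeta> - 2\<close> is a natural number subtraction; it is the intended
  one for \<open>\<zeta> \<ge> 2\<close>.
\<close>

definition weight :: "nat \<Rightarrow> adj \<Rightarrow> real \<Rightarrow> nat \<Rightarrow> (nat \<Rightarrow> real) \<Rightarrow> adj \<Rightarrow> real" where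
  "weight \<zeta> H \<theta> n \<beta> G =
     exp (\<theta> / real n ^ (\<zeta> - 2) * inj_count \<zeta> H n G + (\<Sum>i = 1..n. \<beta> i * deg n G i))"

definition Z :: "nat \<Rightarrow> adj \<Rightarrow> real \<Rightarrow> nat \<Rightarrow> (nat \<Rightarrow> real) \<Rightarrow> real" where
  "Z \<zeta> H \<theta> n \<beta> = (\<Sum>G \<in> graphs n. weight \<zeta> H \<theta> n \<beta> G)"

definition ergm :: "nat \<Rightarrow> adj \<Rightarrow> real \<Rightarrow> nat \<Rightarrow> (nat \<Rightarrow> real) \<Rightarrow> adj pmf" where
  "ergm \<zeta> H \<theta> n \<beta> =
     embed_pmf (\<lambda>G. if G \<in> graphs n then weight \<zeta> H \<theta> n \<beta> G / Z \<zeta> H \<theta> n \<beta> else 0)"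

lemma finite_graphs: "finite (graphs n)"
proof -
  let ?S = "{1..n} \<times> {1..n}"
  let ?f = "\<lambda>G :: adj. restrict (case_prod G) ?S"
  have "inj_on ?f (graphs n)"
  proof (rule inj_onI)
    fix G G' assume G: "G \<in> graphs n" and G': "G' \<in> graphs n" and eq: "?f G = ?f G'"
    have "G i j = G' i j" for i j
    proof (cases "i \<in> {1..n} \<and> j \<in> {1..n}")
      case True
      then show ?thesis using fun_cong[OF eq, of "(i, j)"] by simp
    next
      case False
      then have "G i j = 0" "G' i j = 0" using G G' unfolding graphs_def by blast+
      then show ?thesis by simp
    qed
    then show "G = G'" by blast
  qed
  moreover have "?f ` graphs n \<subseteq> ?S \<rightarrow>\<^sub>E {0, 1}"
    by (force simp: graphs_def restrict_def PiE_def extensional_def)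
  moreover have "finite (?S \<rightarrow>\<^sub>E {0, 1 :: real})" by (intro finite_PiE) auto
  ultimately show ?thesis by (meson finite_imageD finite_subset)
qed

lemma Z_pos: "Z \<zeta> H \<theta> n \<beta> > 0"
proof -
  have "(\<lambda>_ _. 0) \<in> graphs n" by (simp add: graphs_def)
  then show ?thesis
    unfolding Z_def by (intro sum_pos finite_graphs) (auto simp: weight_def)
qed

lemma pmf_ergm:
  "pmf (ergm \<zeta> H \<theta> n \<beta>) G =
     (if G \<in> graphs n then weight \<zeta> H \<theta> n \<beta> G / Z \<zeta> H \<theta> n \<beta> else 0)"
proof -
  let ?p = "\<lambda>G. if G \<in> graphs n then weight \<zeta> H \<theta> n \<beta> G / Z \<zeta> H \<theta> n \<beta> else 0"
  have nonneg: "0 \<le> ?p G" for G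
    using Z_pos[of \<zeta> H \<theta> n \<beta>] by (simp add: weight_def)
  have "(\<integral>\<^sup>+ G. ennreal (?p G) \<partial>count_space UNIV) = (\<Sum>G \<in> graphs n. ennreal (?p G))"
    by (intro nn_integral_count_space'[OF finite_graphs]) auto
  also have "\<dots> = ennreal (\<Sum>G \<in> graphs n. ?p G)"
    using nonneg by (intro sum_ennreal)
  also have "(\<Sum>G \<in> graphs n. ?p G) = (\<Sum>G \<in> graphs n. weight \<zeta> H \<theta> n \<beta> G) / Z \<zeta> H \<theta> n \<beta>"
    by (simp add: sum_divide_distrib)
  also have "\<dots> = 1" using Z_pos[of \<zeta> H \<theta> n \<beta>] by (simp flip: Z_def)
  finally show ?thesis unfolding ergm_def using nonneg by (subst pmf_embed_pmf) auto
qed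

lemma set_pmf_ergm: "set_pmf (ergm \<zeta> H \<theta> n \<beta>) = graphs n"
  using Z_pos[of \<zeta> H \<theta> n \<beta>] by (auto simp: set_pmf_iff pmf_ergm weight_def split: if_splits)

text \<open>
  The value at the observed graph \<open>G\<close> of the conditional expectation of \<open>G\<^sub>e\<close> given all the other
  edge indicators. Every graph has positive probability, so the event conditioned on meets the
  support of the model whenever \<open>G \<in> graphs n\<close>, as \<^const>\<open>cond_pmf\<close> requires.
\<close>

definition edge_cond_exp ::
  "nat \<Rightarrow> adj \<Rightarrow> real \<Rightarrow> nat \<Rightarrow> (nat \<Rightarrow> real) \<Rightarrow> nat \<times> nat \<Rightarrow> adj \<Rightarrow> real" where
  "edge_cond_exp \<zeta> H \<theta> n \<beta> e G =
     measure_pmf.expectation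
       (cond_pmf (ergm \<zeta> H \<theta> n \<beta>)
          {G'. \<forall>f \<in> pairs n - {e}. case_prod G' f = case_prod G f})
       (\<lambda>G'. case_prod G' e)"

definition sum_deg_test ::
  "nat \<Rightarrow> adj \<Rightarrow> real \<Rightarrow> real \<Rightarrow> nat \<Rightarrow> real \<Rightarrow> adj \<Rightarrow> nat" where
  "sum_deg_test \<zeta> H \<theta> \<beta>\<^sub>0 n l G =
     (if (\<Sum>e \<in> pairs n. case_prod G e - edge_cond_exp \<zeta> H \<theta> n (\<lambda>_. \<beta>\<^sub>0) e G) > l then 1 else 0)"

text \<open>
  In \<open>\<Xi>\<close> the condition \<open>min \<mu>\<^sub>i \<ge> A\<close> over the support is stated for every element, and is
  therefore void for an empty support, which is possible only if \<open>s = 0\<close>.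
\<close>

definition supp :: "nat \<Rightarrow> (nat \<Rightarrow> real) \<Rightarrow> nat set" where
  "supp n \<mu> = {i \<in> {1..n}. \<mu> i \<noteq> 0}"

definition \<Xi> :: "nat \<Rightarrow> real \<Rightarrow> nat \<Rightarrow> real \<Rightarrow> (nat \<Rightarrow> real) set" where
  "\<Xi> n \<beta>\<^sub>0 s A = {\<beta>. \<exists>\<mu>. \<beta> = (\<lambda>i. \<beta>\<^sub>0 + \<mu> i) \<and> card (supp n \<mu>) \<ge> s \<and> (\<forall>i \<in> supp n \<mu>. \<mu> i \<ge> A)}"

text \<open>
  \<open>a \<lless> b\<close> is the relation \<open>a\<^sub>n / b\<^sub>n \<longlonglongrightarrow> 0\<close> between sequences with \<open>b\<close> eventually positive.
  Positivity is made explicit because it is needed for the quotient to be meaningful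
  (\<open>x / 0 = 0\<close> here), and because a negative threshold is not meant.
\<close>

definition much_less :: "(nat \<Rightarrow> real) \<Rightarrow> (nat \<Rightarrow> real) \<Rightarrow> bool"  (infix \<open>\<lless>\<close> 50) where
  "a \<lless> b \<longleftrightarrow> (\<forall>\<^sub>F n in sequentially. b n > 0) \<and> (\<lambda>n. a n / b n) \<longlonglongrightarrow> 0"

text \<open>
  The theorem is used with a threshold satisfying \<open>L \<lless> n s\<close> in addition to \<open>n \<lless> L \<lless> n s A\<close>.
  The additional condition follows from \<open>L \<lless> n s A\<close> when \<open>A\<close> is bounded. For unbounded \<open>A\<close>
  it cannot simply be dropped: the statistic is at most \<open>n\<^sup>2 / 2\<close>, so with \<open>s = A = n\<close> and
  \<open>L = n powr (5/2)\<close> the test never rejects for \<open>n \<ge> 1\<close>.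
\<close>

end

theory Submission
  imports Defs
begin

text \<open>
  Resampling one edge from its conditional law leaves the model invariant, so each summand
  \<open>G\<^sub>e - p\<^sub>e(G)\<close> is orthogonal to every function of the other edges. Flipping \<open>e\<close> changes the
  conditional probabilities \<open>p\<^sub>f\<close> of the other edges by \<open>O(1)\<close> in total, because only
  \<open>O(n\<^bsup>\<zeta>-2\<^esup>)\<close> copies of \<open>H\<close> use \<open>e\<close>. Hence the centred sum has second moment \<open>O(n\<^sup>2)\<close>, uniformly in
  \<open>\<beta>\<close>, and Chebyshev's inequality applies at scale \<open>L \<ggreater> n\<close> both under the null and, when one
  centres with the true \<open>\<beta>\<close>, under the alternative. Since the null log-odds of an edge stay bounded,
  the two centrings differ deterministically by at least a constant times \<open>n s min(A, 1)\<close>,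
  which dominates \<open>L\<close>.
\<close>

section \<open>Sums of conditionally centred variables\<close>

text \<open>Balance makes \<open>w * D e\<close> odd under the involution \<open>\<phi> e\<close>.
  Hence in the product of \<open>D e\<close> with the sum \<open>T e\<close> of the other variables,
  \<open>T e\<close> may be replaced by half its change under \<open>\<phi> e\<close>, which
  \<open>K\<close> controls. Each \<open>e\<close> thus costs at most 1 on the diagonal and
  \<open>K / 2\<close> off it. In the application \<open>\<phi> e\<close> flips an edge and
  \<open>w\<close> is the model.\<close>

lemma second_moment_balanced:
  fixes w :: "'a \<Rightarrow> real" and D :: "'e \<Rightarrow> 'a \<Rightarrow> real" and \<phi> :: "'e \<Rightarrow> 'a \<Rightarrow> 'a"
  assumes fin: "finite E"
    and closed: "\<And>e x. e \<in> E \<Longrightarrow> x \<in> X \<Longrightarrow> \<phi> e x \<in> X"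
    and invol: "\<And>e x. e \<in> E \<Longrightarrow> x \<in> X \<Longrightarrow> \<phi> e (\<phi> e x) = x"
    and w: "\<And>x. x \<in> X \<Longrightarrow> 0 \<le> w x" "sum w X = 1"
    and balance: "\<And>e x. e \<in> E \<Longrightarrow> x \<in> X \<Longrightarrow> w (\<phi> e x) * D e (\<phi> e x) = - (w x * D e x)"
    and D: "\<And>e x. e \<in> E \<Longrightarrow> x \<in> X \<Longrightarrow> \<bar>D e x\<bar> \<le> 1"
    and K: "\<And>e x. e \<in> E \<Longrightarrow> x \<in> X \<Longrightarrow> (\<Sum>f \<in> E - {e}. \<bar>D f (\<phi> e x) - D f x\<bar>) \<le> K"
  shows "(\<Sum>x\<in>X. w x * (\<Sum>e\<in>E. D e x)\<^sup>2) \<le> real (card E) * (1 + K / 2)"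
proof -
  define T where "T e x = (\<Sum>f \<in> E - {e}. D f x)" for e x
  have cross: "(\<Sum>x\<in>X. w x * (D e x * T e x)) \<le> K / 2" if e: "e \<in> E" for e
  proof -
    have "(\<Sum>x\<in>X. w x * (D e x * T e x)) = (\<Sum>x\<in>X. w (\<phi> e x) * (D e (\<phi> e x) * T e (\<phi> e x)))"
      by (rule sum.reindex_bij_witness[of _ "\<phi> e" "\<phi> e"]) (use closed invol e in auto)
    also have "\<dots> = (\<Sum>x\<in>X. - (w x * (D e x * T e (\<phi> e x))))"
    proof (intro sum.cong refl)
      fix x assume x: "x \<in> X"
      have "w (\<phi> e x) * (D e (\<phi> e x) * T e (\<phi> e x)) = (w (\<phi> e x) * D e (\<phi> e x)) * T e (\<phi> e x)"
        by simp
      then show "w (\<phi> e x) * (D e (\<phi> e x) * T e (\<phi> e x)) = - (w x * (D e x * T e (\<phi> e x)))"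
        by (simp add: balance[OF e x])
    qed
    \<comment> \<open>Adding the original cross term to its reindexed form leaves only the increment
      of \<open>T e\<close> along \<open>\<phi> e\<close>.\<close>
    finally have "2 * (\<Sum>x\<in>X. w x * (D e x * T e x))
        = (\<Sum>x\<in>X. w x * (D e x * (T e x - T e (\<phi> e x))))"
      by (simp add: sum_negf sum_subtractf algebra_simps)
    also have "\<dots> \<le> (\<Sum>x\<in>X. w x * K)"
    proof (intro sum_mono mult_left_mono w)
      fix x assume x: "x \<in> X"
      have "D e x * (T e x - T e (\<phi> e x)) \<le> \<bar>D e x\<bar> * \<bar>T e x - T e (\<phi> e x)\<bar>"
        by (metis abs_ge_self abs_mult)
      also have "\<dots> \<le> 1 * \<bar>T e x - T e (\<phi> e x)\<bar>"
        by (intro mult_right_mono D e x) simp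
      also have "\<dots> = \<bar>\<Sum>f \<in> E - {e}. D f (\<phi> e x) - D f x\<bar>"
        by (simp add: T_def sum_subtractf abs_minus_commute)
      also have "\<dots> \<le> (\<Sum>f \<in> E - {e}. \<bar>D f (\<phi> e x) - D f x\<bar>)" by (rule sum_abs)
      also have "\<dots> \<le> K" by (rule K[OF e x])
      finally show "D e x * (T e x - T e (\<phi> e x)) \<le> K" .
    qed
    also have "\<dots> = K" using w(2) by (simp flip: sum_distrib_right)
    finally show ?thesis by simp
  qed
  have "(\<Sum>x\<in>X. w x * (\<Sum>e\<in>E. D e x)\<^sup>2) = (\<Sum>x\<in>X. \<Sum>e\<in>E. w x * (D e x * (D e x + T e x)))"
  proof (intro sum.cong refl)
    fix x
    have row: "(\<Sum>f\<in>E. D f x) = D e x + T e x" if "e \<in> E" for e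
      using sum.remove[OF fin that] by (simp add: T_def)
    have "(\<Sum>e\<in>E. D e x)\<^sup>2 = (\<Sum>e\<in>E. D e x * (\<Sum>f\<in>E. D f x))"
      by (simp add: power2_eq_square sum_distrib_right)
    also have "\<dots> = (\<Sum>e\<in>E. D e x * (D e x + T e x))"
      by (intro sum.cong refl arg_cong2[of _ _ _ _ "(*)"] row)
    finally show "w x * (\<Sum>e\<in>E. D e x)\<^sup>2 = (\<Sum>e\<in>E. w x * (D e x * (D e x + T e x)))"
      by (simp add: sum_distrib_left)
  qed
  also have "\<dots> = (\<Sum>e\<in>E. \<Sum>x\<in>X. w x * (D e x * (D e x + T e x)))"
    by (rule sum.swap)
  also have "\<dots> = (\<Sum>e\<in>E. (\<Sum>x\<in>X. w x * (D e x)\<^sup>2) + (\<Sum>x\<in>X. w x * (D e x * T e x)))"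
    by (simp add: algebra_simps sum.distrib power2_eq_square)
  also have "\<dots> \<le> (\<Sum>e\<in>E. 1 + K / 2)"
  proof (intro sum_mono add_mono cross)
    fix e assume e: "e \<in> E"
    have "(\<Sum>x\<in>X. w x * (D e x)\<^sup>2) \<le> (\<Sum>x\<in>X. w x * 1)"
      by (intro sum_mono mult_left_mono w) (use D e in \<open>auto simp: abs_square_le_1\<close>)
    then show "(\<Sum>x\<in>X. w x * (D e x)\<^sup>2) \<le> 1" using w(2) by simp
  qed
  also have "\<dots> = real (card E) * (1 + K / 2)" by simp
  finally show ?thesis .
qed

text \<open>Chebyshev's inequality, with the second moment written as the finite sum that
  \<open>second_moment_balanced\<close> bounds.\<close>

lemma prob_abs_ge_le_second_moment:
  fixes p :: "'a pmf" and f :: "'a \<Rightarrow> real"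
  assumes fin: "finite (set_pmf p)" and a: "a > 0"
    and B: "(\<Sum>x \<in> set_pmf p. pmf p x * (f x)\<^sup>2) \<le> B"
  shows "measure_pmf.prob p {x. \<bar>f x\<bar> \<ge> a} \<le> B / a\<^sup>2"
proof -
  let ?A = "{x \<in> set_pmf p. \<bar>f x\<bar> \<ge> a}"
  have "measure_pmf.prob p {x. \<bar>f x\<bar> \<ge> a} = measure_pmf.prob p ?A"
    by (rule measure_pmf.finite_measure_eq_AE) (auto simp: AE_measure_pmf_iff)
  also have "\<dots> = (\<Sum>x \<in> ?A. pmf p x)"
    using fin by (intro measure_measure_pmf_finite) auto
  finally have prob: "measure_pmf.prob p {x. \<bar>f x\<bar> \<ge> a} = (\<Sum>x \<in> ?A. pmf p x)" .
  have "(\<Sum>x \<in> ?A. pmf p x) * a\<^sup>2 = (\<Sum>x \<in> ?A. pmf p x * a\<^sup>2)" by (simp add: sum_distrib_right)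
  also have "\<dots> \<le> (\<Sum>x \<in> ?A. pmf p x * (f x)\<^sup>2)"
    using a by (intro sum_mono mult_left_mono) (auto simp: abs_le_square_iff[symmetric])
  also have "\<dots> \<le> (\<Sum>x \<in> set_pmf p. pmf p x * (f x)\<^sup>2)"
    by (intro sum_mono2 fin) auto
  also have "\<dots> \<le> B" by (rule B)
  finally show ?thesis using a unfolding prob by (simp add: field_simps)
qed

section \<open>The logistic function\<close>

definition logistic :: "real \<Rightarrow> real" where
  "logistic x = 1 / (1 + exp (- x))"

lemma logistic_bounds: "0 < logistic x" "logistic x < 1"
  unfolding logistic_def by (auto simp: divide_simps add_pos_pos)

lemma logistic_diff_exp: "logistic (ln u - ln v) = u / (u + v)" if "u > 0" "v > 0"
  using that by (simp add: logistic_def exp_diff field_simps)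

text \<open>One exact formula serves both the Lipschitz upper bound and the lower bound on the
  drift.\<close>

lemma logistic_diff:
  "logistic (x + d) - logistic x
     = exp (- (x + d)) * (exp d - 1) / ((1 + exp (- (x + d))) * (1 + exp (- x)))"
proof -
  have "1 + exp (- (x + d)) \<noteq> 0" "1 + exp (- x) \<noteq> 0"
    by (metis add_pos_pos exp_gt_zero less_irrefl zero_less_one)+
  moreover have "exp (- (x + d)) * (exp d - 1) = exp (- x) - exp (- (x + d))"
    by (simp add: algebra_simps flip: exp_add)
  ultimately show ?thesis
    unfolding logistic_def by (simp add: divide_simps)
qed

lemma logistic_mono: "logistic x \<le> logistic y" if "x \<le> y"
  using that unfolding logistic_def
  by (intro divide_left_mono mult_pos_pos add_pos_pos) auto

lemma logistic_lipschitz: "\<bar>logistic x - logistic y\<bar> \<le> \<bar>x - y\<bar>"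
proof -
  have step: "logistic (x + d) - logistic x \<le> d" if d: "0 \<le> d" for x d
  proof -
    have "exp (- d) \<ge> 1 - d" using exp_ge_add_one_self[of "- d"] by simp
    then have "exp (- x) * (1 - exp (- d)) \<le> exp (- x) * d" by (intro mult_left_mono) auto
    moreover have "exp (- (x + d)) * (exp d - 1) = exp (- x) * (1 - exp (- d))"
      by (simp add: algebra_simps flip: exp_add)
    ultimately have num: "exp (- (x + d)) * (exp d - 1) \<le> exp (- x) * d" by simp
    \<comment> \<open>The denominator is at least \<open>exp (- x)\<close>, which absorbs the same
      factor in the numerator.\<close>
    have "exp (- x) * 1 \<le> (1 + exp (- x)) * (1 + exp (- (x + d)))"
      by (intro mult_mono) auto
    then have "exp (- x) * d \<le> d * ((1 + exp (- (x + d))) * (1 + exp (- x)))"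
      using mult_left_mono[OF _ d] by (metis mult.commute mult_1)
    then show ?thesis using num unfolding logistic_diff
      by (subst divide_le_eq) (auto simp: add_pos_pos)
  qed
  show ?thesis
    using step[of "x - y" y] step[of "y - x" x] logistic_mono[of x y] logistic_mono[of y x]
    by (cases "x \<le> y") auto
qed

lemma logistic_diff_ge:
  assumes x: "\<bar>x\<bar> \<le> M" and d: "0 \<le> d" "d \<le> 1" and y: "x + d \<le> y"
  shows "logistic y - logistic x \<ge> exp (- M - 1) / (1 + exp M)\<^sup>2 * d"
proof -
  have "exp (- M - 1) / (1 + exp M)\<^sup>2 * d = exp (- M - 1) * d / ((1 + exp M) * (1 + exp M))"
    by (simp add: power2_eq_square)
  also have "\<dots> \<le> exp (- (x + d)) * (exp d - 1) / ((1 + exp (- (x + d))) * (1 + exp (- x)))"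
  proof (rule frac_le)
    show "exp (- M - 1) * d \<le> exp (- (x + d)) * (exp d - 1)"
    proof (rule mult_mono)
      show "d \<le> exp d - 1" using exp_ge_add_one_self[of d] by linarith
    qed (use x d in auto)
    show "(1 + exp (- (x + d))) * (1 + exp (- x)) \<le> (1 + exp M) * (1 + exp M)"
      using x d by (intro mult_mono add_mono) (auto intro: add_nonneg_nonneg)
  qed (use d in \<open>auto simp: add_pos_pos\<close>)
  also have "\<dots> = logistic (x + d) - logistic x" by (rule logistic_diff[symmetric])
  also have "\<dots> \<le> logistic y - logistic x" using logistic_mono[OF y] by simp
  finally show ?thesis .
qed

section \<open>Setting one edge and counting copies of the subgraph\<close>

text \<open>Both orientations are overwritten, so that the adjacency matrix stays symmetric.\<close>

definition put :: "nat \<times> nat \<Rightarrow> real \<Rightarrow> adj \<Rightarrow> adj" where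
  "put e b G = (\<lambda>i j. if (i, j) = e \<or> (j, i) = e then b else G i j)"

definition flip :: "nat \<times> nat \<Rightarrow> adj \<Rightarrow> adj" where
  "flip e G = put e (1 - case_prod G e) G"

lemma finite_pairs: "finite (pairs n)"
  by (rule finite_subset[of _ "{1..n} \<times> {1..n}"]) (auto simp: pairs_def)

lemma card_pairs_le: "card (pairs n) \<le> n\<^sup>2"
proof -
  have "card (pairs n) \<le> card ({1..n} \<times> {1..n})"
    by (rule card_mono) (auto simp: pairs_def)
  then show ?thesis by (simp add: power2_eq_square)
qed

lemma graph_entry: "G \<in> graphs n \<Longrightarrow> G i j = 0 \<or> G i j = 1"
  unfolding graphs_def by blast

lemma graph_sym: "G \<in> graphs n \<Longrightarrow> G i j = G j i"
  unfolding graphs_def by blast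

lemma put_graph: "G \<in> graphs n \<Longrightarrow> e \<in> pairs n \<Longrightarrow> b = 0 \<or> b = 1 \<Longrightarrow> put e b G \<in> graphs n"
  unfolding graphs_def put_def pairs_def by auto

lemma put_at [simp]: "case_prod (put e b G) e = b"
  by (cases e) (simp add: put_def)

lemma put_put [simp]: "put e b (put e c G) = put e b G"
  by (auto simp: put_def fun_eq_iff)

lemma put_same: "G \<in> graphs n \<Longrightarrow> case_prod G e = b \<Longrightarrow> put e b G = G"
  using graph_sym[of G n] by (auto simp: put_def fun_eq_iff)

lemma put_other: "e \<in> pairs n \<Longrightarrow> f \<in> pairs n \<Longrightarrow> f \<noteq> e \<Longrightarrow> case_prod (put e b G) f = case_prod G f"
  by (cases e, cases f) (auto simp: put_def pairs_def)

lemma flip_graph: "G \<in> graphs n \<Longrightarrow> e \<in> pairs n \<Longrightarrow> flip e G \<in> graphs n"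
  unfolding flip_def using graph_entry[of G n] by (intro put_graph) (auto split: prod.splits)

lemma flip_flip: "G \<in> graphs n \<Longrightarrow> flip e (flip e G) = G"
  unfolding flip_def by (simp add: put_same)

section \<open>Copies of \<open>H\<close> through a given edge\<close>

definition embeddings :: "nat \<Rightarrow> nat \<Rightarrow> (nat \<Rightarrow> nat) set" where
  "embeddings \<zeta> n = {\<iota> \<in> {1..\<zeta>} \<rightarrow>\<^sub>E {1..n}. inj_on \<iota> {1..\<zeta>}}"

definition copy :: "nat \<Rightarrow> adj \<Rightarrow> (nat \<Rightarrow> nat) \<Rightarrow> adj \<Rightarrow> real" where
  "copy \<zeta> H \<iota> G = (\<Prod>(i, j) \<in> edges \<zeta> H. G (\<iota> i) (\<iota> j))"

text \<open>Both orientations are allowed because pairs are stored in increasing order while \<iota>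
  need not be monotone.\<close>

definition covers :: "nat \<Rightarrow> adj \<Rightarrow> (nat \<Rightarrow> nat) \<Rightarrow> nat \<times> nat \<Rightarrow> bool" where
  "covers \<zeta> H \<iota> e \<longleftrightarrow> (\<exists>(i, j) \<in> edges \<zeta> H. (\<iota> i, \<iota> j) = e \<or> (\<iota> j, \<iota> i) = e)"

text \<open>The discrete derivative of \<open>N(H, G)\<close> in the coordinate \<open>e\<close>;
  the value of \<open>G\<close> at \<open>e\<close> does not enter.\<close>

definition edge_incr :: "nat \<Rightarrow> adj \<Rightarrow> nat \<Rightarrow> nat \<times> nat \<Rightarrow> adj \<Rightarrow> real" where
  "edge_incr \<zeta> H n e G = inj_count \<zeta> H n (put e 1 G) - inj_count \<zeta> H n (put e 0 G)"

lemma finite_embeddings: "finite (embeddings \<zeta> n)"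
  by (rule finite_subset[of _ "{1..\<zeta>} \<rightarrow>\<^sub>E {1..n}"]) (auto simp: embeddings_def intro: finite_PiE)

lemma finite_edges: "finite (edges \<zeta> H)"
  by (rule finite_subset[OF _ finite_pairs[of \<zeta>]]) (auto simp: edges_def)

lemma inj_count_eq: "inj_count \<zeta> H n G = (\<Sum>\<iota> \<in> embeddings \<zeta> n. copy \<zeta> H \<iota> G)"
  by (simp add: inj_count_def embeddings_def copy_def)

lemma edge_incr_eq:
  "edge_incr \<zeta> H n e G
     = (\<Sum>\<iota> \<in> embeddings \<zeta> n. copy \<zeta> H \<iota> (put e 1 G) - copy \<zeta> H \<iota> (put e 0 G))"
  by (simp add: edge_incr_def inj_count_eq sum_subtractf)

lemma copy_bounds:
  assumes "G \<in> graphs n"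
  shows "0 \<le> copy \<zeta> H \<iota> G" "copy \<zeta> H \<iota> G \<le> 1"
proof -
  have "0 \<le> G i j \<and> G i j \<le> 1" for i j using graph_entry[OF assms, of i j] by auto
  then show "0 \<le> copy \<zeta> H \<iota> G" "copy \<zeta> H \<iota> G \<le> 1"
    unfolding copy_def by (auto intro!: prod_nonneg prod_le_1)
qed

text \<open>A copy reads the graph only at the images of the edges of \<open>H\<close>, so a change
  at an uncovered pair is invisible to it.\<close>

lemma copy_cong:
  assumes "\<not> covers \<zeta> H \<iota> e" "\<And>i j. (i, j) \<noteq> e \<Longrightarrow> (j, i) \<noteq> e \<Longrightarrow> G i j = G' i j"
  shows "copy \<zeta> H \<iota> G = copy \<zeta> H \<iota> G'"
  unfolding copy_def using assms by (intro prod.cong) (auto simp: covers_def)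

text \<open>Two values are prescribed and each of the other \<open>\<zeta> - 2\<close> has at most
  \<open>n\<close> choices; the upper bound forgets injectivity.\<close>

lemma card_embeddings_at:
  assumes "i \<in> {1..\<zeta>}" "j \<in> {1..\<zeta>}" "i \<noteq> j"
  shows "card {\<iota> \<in> embeddings \<zeta> n. \<iota> i = u \<and> \<iota> j = v} \<le> n ^ (\<zeta> - 2)"
proof -
  let ?B = "\<lambda>k. if k = i then {u} else if k = j then {v} else {1..n}"
  have "card {\<iota> \<in> embeddings \<zeta> n. \<iota> i = u \<and> \<iota> j = v} \<le> card (PiE {1..\<zeta>} ?B)"
    by (rule card_mono) (auto simp: embeddings_def PiE_iff extensional_def intro!: finite_PiE)
  also have "\<dots> = (\<Prod>k \<in> {1..\<zeta>}. if k = i \<or> k = j then 1 else n)"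
    by (subst card_PiE) (auto intro!: prod.cong)
  also have "\<dots> = (\<Prod>k \<in> {1..\<zeta>} - {i, j}. n)"
    by (intro prod.mono_neutral_cong_right) auto
  also have "\<dots> = n ^ (\<zeta> - 2)"
    using assms by (simp add: card_Diff_subset numeral_2_eq_2)
  finally show ?thesis .
qed

text \<open>Choose the edge of \<open>H\<close> that is sent to \<open>e\<close> and one of its two
  orientations; then two values of \<iota> are fixed.\<close>

lemma card_covering:
  "real (card {\<iota> \<in> embeddings \<zeta> n. covers \<zeta> H \<iota> e})
     \<le> 2 * real (card (edges \<zeta> H)) * real n ^ (\<zeta> - 2)"
proof -
  let ?C = "\<lambda>i j u v. {\<iota> \<in> embeddings \<zeta> n. \<iota> i = u \<and> \<iota> j = v}"
  obtain u v where e: "e = (u, v)" by force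
  have "card {\<iota> \<in> embeddings \<zeta> n. covers \<zeta> H \<iota> e}
      \<le> card (\<Union>(i, j) \<in> edges \<zeta> H. ?C i j u v \<union> ?C i j v u)"
    by (intro card_mono finite_UN_I finite_edges)
       (auto simp: covers_def e finite_embeddings split: prod.splits)
  also have "\<dots> \<le> (\<Sum>(i, j) \<in> edges \<zeta> H. card (?C i j u v \<union> ?C i j v u))"
    using card_UN_le[OF finite_edges[of \<zeta> H], of "\<lambda>(i, j). ?C i j u v \<union> ?C i j v u"]
    by (simp add: case_prod_unfold)
  also have "\<dots> \<le> (\<Sum>(i, j) \<in> edges \<zeta> H. 2 * n ^ (\<zeta> - 2))"
  proof (intro sum_mono, clarify)
    fix i j assume "(i, j) \<in> edges \<zeta> H"
    then have "i \<in> {1..\<zeta>}" "j \<in> {1..\<zeta>}" "i \<noteq> j" by (auto simp: edges_def pairs_def)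
    from card_embeddings_at[OF this, of n u v] card_embeddings_at[OF this, of n v u]
    show "card (?C i j u v \<union> ?C i j v u) \<le> 2 * n ^ (\<zeta> - 2)"
      using card_Un_le[of "?C i j u v" "?C i j v u"] by linarith
  qed
  finally have "card {\<iota> \<in> embeddings \<zeta> n. covers \<zeta> H \<iota> e}
      \<le> 2 * card (edges \<zeta> H) * n ^ (\<zeta> - 2)"
    by (simp add: case_prod_unfold)
  from of_nat_mono[OF this, where ?'a = real] show ?thesis by simp
qed

text \<open>The dual count: an edge of \<open>H\<close> can cover only one pair, its image sorted by
  \<open>min\<close> and \<open>max\<close>.\<close>

lemma card_covered: "card {e \<in> pairs n. covers \<zeta> H \<iota> e} \<le> card (edges \<zeta> H)"
proof -
  let ?g = "\<lambda>(i, j). (min (\<iota> i) (\<iota> j), max (\<iota> i) (\<iota> j))"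
  have "{e \<in> pairs n. covers \<zeta> H \<iota> e} \<subseteq> ?g ` edges \<zeta> H"
    by (force simp: pairs_def covers_def)
  then show ?thesis using surj_card_le[OF finite_edges] by blast
qed

text \<open>Only embeddings covering \<open>e\<close> feel the edge, and each changes by at most 1.
  After scaling by \<open>n ^ (\<zeta> - 2)\<close> the interaction part of the log-odds is
  therefore bounded uniformly in \<open>n\<close>.\<close>

lemma edge_incr_bound:
  assumes G: "G \<in> graphs n" and e: "e \<in> pairs n"
  shows "\<bar>edge_incr \<zeta> H n e G\<bar> \<le> 2 * real (card (edges \<zeta> H)) * real n ^ (\<zeta> - 2)"
proof -
  have "\<bar>edge_incr \<zeta> H n e G\<bar>
      \<le> (\<Sum>\<iota> \<in> embeddings \<zeta> n. \<bar>copy \<zeta> H \<iota> (put e 1 G) - copy \<zeta> H \<iota> (put e 0 G)\<bar>)"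
    unfolding edge_incr_eq by (rule sum_abs)
  also have "\<dots> \<le> (\<Sum>\<iota> \<in> embeddings \<zeta> n. if covers \<zeta> H \<iota> e then 1 else 0)"
  proof (rule sum_mono)
    fix \<iota>
    have "copy \<zeta> H \<iota> (put e 1 G) = copy \<zeta> H \<iota> (put e 0 G)" if "\<not> covers \<zeta> H \<iota> e"
      using that by (rule copy_cong) (simp add: put_def)
    moreover note copy_bounds[OF put_graph[OF G e], of 1 \<zeta> H \<iota>]
      copy_bounds[OF put_graph[OF G e], of 0 \<zeta> H \<iota>]
    ultimately show "\<bar>copy \<zeta> H \<iota> (put e 1 G) - copy \<zeta> H \<iota> (put e 0 G)\<bar>
        \<le> (if covers \<zeta> H \<iota> e then 1 else 0)"
      by auto
  qed
  also have "\<dots> = real (card {\<iota> \<in> embeddings \<zeta> n. covers \<zeta> H \<iota> e})"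
    by (simp add: sum.If_cases[OF finite_embeddings] Int_def)
  also have "\<dots> \<le> 2 * real (card (edges \<zeta> H)) * real n ^ (\<zeta> - 2)"
    by (rule card_covering)
  finally show ?thesis .
qed

text \<open>A mixed second difference: the term of \<iota> at \<open>f\<close> reacts to flipping
  \<open>e\<close> only if \<iota> covers both pairs. With \<open>m\<close> edges in
  \<open>H\<close>, at most \<open>2 * m * n ^ (\<zeta> - 2)\<close> embeddings cover
  \<open>e\<close>, each covers at most \<open>m\<close> pairs \<open>f\<close>, and each such term
  moves by at most 2.\<close>

lemma edge_incr_change:
  assumes G: "G \<in> graphs n" and e: "e \<in> pairs n"
  shows "(\<Sum>f \<in> pairs n. \<bar>edge_incr \<zeta> H n f (flip e G) - edge_incr \<zeta> H n f G\<bar>)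
           \<le> 4 * (real (card (edges \<zeta> H)))\<^sup>2 * real n ^ (\<zeta> - 2)"
proof -
  let ?m = "real (card (edges \<zeta> H))"
  define d where "d f \<iota> G = copy \<zeta> H \<iota> (put f 1 G) - copy \<zeta> H \<iota> (put f 0 G)" for f \<iota> G
  have d_zero: "d f \<iota> G' = 0" if "\<not> covers \<zeta> H \<iota> f" for f \<iota> G'
    using copy_cong[OF that, of "put f 1 G'" "put f 0 G'"] by (simp add: d_def put_def)
  have d_flip: "d f \<iota> (flip e G) = d f \<iota> G" if "\<not> covers \<zeta> H \<iota> e" for f \<iota>
  proof -
    have "copy \<zeta> H \<iota> (put f b (flip e G)) = copy \<zeta> H \<iota> (put f b G)" for b
      using that by (rule copy_cong) (simp add: put_def flip_def)
    then show ?thesis by (simp add: d_def)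
  qed
  have d_bound: "\<bar>d f \<iota> G'\<bar> \<le> 1" if "G' \<in> graphs n" "f \<in> pairs n" for f \<iota> G'
    using copy_bounds[OF put_graph[OF that], of 1 \<zeta> H \<iota>] copy_bounds[OF put_graph[OF that], of 0 \<zeta> H \<iota>]
    by (auto simp: d_def)
  have "(\<Sum>f \<in> pairs n. \<bar>edge_incr \<zeta> H n f (flip e G) - edge_incr \<zeta> H n f G\<bar>)
      = (\<Sum>f \<in> pairs n. \<bar>\<Sum>\<iota> \<in> embeddings \<zeta> n. d f \<iota> (flip e G) - d f \<iota> G\<bar>)"
    by (simp add: edge_incr_eq d_def sum_subtractf)
  also have "\<dots> \<le> (\<Sum>f \<in> pairs n. \<Sum>\<iota> \<in> embeddings \<zeta> n. \<bar>d f \<iota> (flip e G) - d f \<iota> G\<bar>)"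
    by (intro sum_mono sum_abs)
  \<comment> \<open>With \<iota> outermost, \<open>card_covered\<close> bounds the inner sum and
    \<open>card_covering\<close> the outer one.\<close>
  also have "\<dots> = (\<Sum>\<iota> \<in> embeddings \<zeta> n. \<Sum>f \<in> pairs n. \<bar>d f \<iota> (flip e G) - d f \<iota> G\<bar>)"
    by (rule sum.swap)
  also have "\<dots> \<le> (\<Sum>\<iota> \<in> embeddings \<zeta> n. if covers \<zeta> H \<iota> e then 2 * ?m else 0)"
  proof (rule sum_mono)
    fix \<iota>
    show "(\<Sum>f \<in> pairs n. \<bar>d f \<iota> (flip e G) - d f \<iota> G\<bar>) \<le> (if covers \<zeta> H \<iota> e then 2 * ?m else 0)"
    proof (cases "covers \<zeta> H \<iota> e")
      case True
      have "(\<Sum>f \<in> pairs n. \<bar>d f \<iota> (flip e G) - d f \<iota> G\<bar>)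
          \<le> (\<Sum>f \<in> pairs n. if covers \<zeta> H \<iota> f then 2 else 0)"
      proof (rule sum_mono)
        fix f assume f: "f \<in> pairs n"
        show "\<bar>d f \<iota> (flip e G) - d f \<iota> G\<bar> \<le> (if covers \<zeta> H \<iota> f then 2 else 0)"
          using d_bound[OF G f, of \<iota>] d_bound[OF flip_graph[OF G e] f, of \<iota>] d_zero[of \<iota> f] by auto
      qed
      also have "\<dots> = 2 * real (card {f \<in> pairs n. covers \<zeta> H \<iota> f})"
        by (simp add: sum.If_cases[OF finite_pairs] Int_def)
      also have "\<dots> \<le> 2 * ?m" using card_covered[of n \<zeta> H \<iota>] by simp
      finally show ?thesis using True by simp
    qed (simp add: d_flip)
  qed
  also have "\<dots> = 2 * ?m * real (card {\<iota> \<in> embeddings \<zeta> n. covers \<zeta> H \<iota> e})"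
    by (simp add: sum.If_cases[OF finite_embeddings] Int_def)
  also have "\<dots> \<le> 2 * ?m * (2 * ?m * real n ^ (\<zeta> - 2))"
    by (intro mult_left_mono card_covering) simp
  finally show ?thesis by (simp add: power2_eq_square algebra_simps)
qed

section \<open>Conditional edge probabilities\<close>

text \<open>The explicit form of \<open>edge_cond_exp\<close>: the log-odds of \<open>e\<close> are
  the exponent of the weight with \<open>e\<close> present minus the exponent with \<open>e\<close>
  absent.\<close>

definition edge_prob ::
  "nat \<Rightarrow> adj \<Rightarrow> real \<Rightarrow> nat \<Rightarrow> (nat \<Rightarrow> real) \<Rightarrow> nat \<times> nat \<Rightarrow> adj \<Rightarrow> real" where
  "edge_prob \<zeta> H \<theta> n \<beta> e G =
     logistic (\<theta> / real n ^ (\<zeta> - 2) * edge_incr \<zeta> H n e G + \<beta> (fst e) + \<beta> (snd e))"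

lemma sum_deg_put:
  assumes e: "e \<in> pairs n"
  shows "(\<Sum>i = 1..n. \<beta> i * deg n (put e 1 G) i) - (\<Sum>i = 1..n. \<beta> i * deg n (put e 0 G) i)
           = \<beta> (fst e) + \<beta> (snd e)"
proof -
  obtain u v where uv: "e = (u, v)" "u \<in> {1..n}" "v \<in> {1..n}" "u \<noteq> v"
    using e by (cases e) (auto simp: pairs_def)
  have "(\<Sum>i = 1..n. \<beta> i * deg n (put e 1 G) i) - (\<Sum>i = 1..n. \<beta> i * deg n (put e 0 G) i)
      = (\<Sum>i = 1..n. \<beta> i * (\<Sum>j = 1..n. put e 1 G i j - put e 0 G i j))"
    by (simp add: deg_def sum_subtractf right_diff_distrib)
  \<comment> \<open>The difference matrix has ones exactly at \<open>(u, v)\<close> and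
    \<open>(v, u)\<close>; the nested conditionals let each sum collapse to a single index.\<close>
  also have "\<dots> = (\<Sum>i = 1..n. \<beta> i * (\<Sum>j = 1..n. (if i = u then if j = v then 1 else 0 else 0)
                                                + (if i = v then if j = u then 1 else 0 else 0)))"
    using uv(4) by (intro sum.cong arg_cong2[of _ _ _ _ "(*)"]) (auto simp: put_def uv(1))
  also have "\<dots> = (\<Sum>i = 1..n. (if i = u then \<beta> i else 0) + (if i = v then \<beta> i else 0))"
    using uv by (intro sum.cong) (auto simp: sum.distrib)
  also have "\<dots> = \<beta> u + \<beta> v" using uv by (simp add: sum.distrib)
  finally show ?thesis by (simp add: uv(1))
qed

lemma weight_pos: "weight \<zeta> H \<theta> n \<beta> G > 0"
  by (simp add: weight_def)

lemma edge_prob_eq_weight: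
  assumes "e \<in> pairs n"
  shows "edge_prob \<zeta> H \<theta> n \<beta> e G = weight \<zeta> H \<theta> n \<beta> (put e 1 G) /
           (weight \<zeta> H \<theta> n \<beta> (put e 1 G) + weight \<zeta> H \<theta> n \<beta> (put e 0 G))"
proof -
  have "\<theta> / real n ^ (\<zeta> - 2) * edge_incr \<zeta> H n e G + \<beta> (fst e) + \<beta> (snd e)
      = ln (weight \<zeta> H \<theta> n \<beta> (put e 1 G)) - ln (weight \<zeta> H \<theta> n \<beta> (put e 0 G))"
    using sum_deg_put[OF assms, of \<beta> G]
    by (simp add: weight_def edge_incr_def right_diff_distrib)
  then show ?thesis
    unfolding edge_prob_def by (simp only: logistic_diff_exp weight_pos)
qed

text \<open>The conditional probability is a function of the other edges alone, hence unchanged by a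
  flip of \<open>e\<close>.\<close>

lemma edge_prob_put: "edge_prob \<zeta> H \<theta> n \<beta> e (put e b G) = edge_prob \<zeta> H \<theta> n \<beta> e G"
  by (simp add: edge_prob_def edge_incr_def)

lemma edge_prob_bounds: "0 < edge_prob \<zeta> H \<theta> n \<beta> e G" "edge_prob \<zeta> H \<theta> n \<beta> e G < 1"
  unfolding edge_prob_def by (rule logistic_bounds)+

text \<open>Symmetry and the zero entries on the diagonal and out of range make a graph determined
  by its values on \<open>pairs n\<close>, so only the value at \<open>e\<close> is left
  free.\<close>

lemma graphs_agree_off_edge:
  assumes G: "G \<in> graphs n" and e: "e \<in> pairs n"
  shows "graphs n \<inter> {G'. \<forall>f \<in> pairs n - {e}. case_prod G' f = case_prod G f}
           = {put e 0 G, put e 1 G}"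
proof (intro equalityI subsetI)
  fix G' assume "G' \<in> graphs n \<inter> {G'. \<forall>f \<in> pairs n - {e}. case_prod G' f = case_prod G f}"
  then have G': "G' \<in> graphs n"
    and off_e: "\<forall>f \<in> pairs n - {e}. case_prod G' f = case_prod G f" by blast+
  have agree: "G' i j = G i j" if "(i, j) \<in> pairs n" "(i, j) \<noteq> e" for i j
    using bspec[OF off_e, of "(i, j)"] that by simp
  have "G' i j = put e (case_prod G' e) G i j" for i j
  proof -
    consider "(i, j) = e \<or> (j, i) = e" | "(i, j) \<noteq> e" "(j, i) \<noteq> e" "(i, j) \<in> pairs n"
      | "(i, j) \<noteq> e" "(j, i) \<noteq> e" "(j, i) \<in> pairs n" | "(i, j) \<notin> pairs n" "(j, i) \<notin> pairs n"
      by blast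
    then show ?thesis
    proof cases
      case 1
      then show ?thesis using graph_sym[OF G', of i j] by (auto simp: put_def)
    next
      case 2
      then show ?thesis using agree by (auto simp: put_def)
    next
      case 3
      then show ?thesis using agree[of j i] graph_sym[OF G', of i j] graph_sym[OF G, of i j]
        by (auto simp: put_def)
    next
      case 4
      \<comment> \<open>When neither orientation is a pair, the entry is diagonal or out of range
        and vanishes in both graphs.\<close>
      then have "i = j \<or> i \<notin> {1..n} \<or> j \<notin> {1..n}" by (auto simp: pairs_def)
      then have "G' i j = 0" "G i j = 0" using G G' unfolding graphs_def by blast+
      then show ?thesis using 4 e by (auto simp: put_def)
    qed
  qed
  then have "G' = put e (case_prod G' e) G" by blast
  moreover have "case_prod G' e = 0 \<or> case_prod G' e = 1"
    using graph_entry[OF G'] by (cases e) auto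
  ultimately show "G' \<in> {put e 0 G, put e 1 G}" by (metis insertCI)
next
  fix G' assume "G' \<in> {put e 0 G, put e 1 G}"
  then obtain b where b: "b = 0 \<or> b = 1" "G' = put e b G" by blast
  then show "G' \<in> graphs n \<inter> {G'. \<forall>f \<in> pairs n - {e}. case_prod G' f = case_prod G f}"
    using put_graph[OF G e b(1)] put_other[OF e, of _ b G] by blast
qed

text \<open>The conditional law lives on two graphs, and \<open>Z\<close> cancels from the ratio of
  their probabilities.\<close>

lemma edge_cond_exp_eq:
  assumes G: "G \<in> graphs n" and e: "e \<in> pairs n"
  shows "edge_cond_exp \<zeta> H \<theta> n \<beta> e G = edge_prob \<zeta> H \<theta> n \<beta> e G"
proof -
  let ?p = "ergm \<zeta> H \<theta> n \<beta>" and ?G0 = "put e 0 G" and ?G1 = "put e 1 G"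
  let ?S = "{G'. \<forall>f \<in> pairs n - {e}. case_prod G' f = case_prod G f}"
  let ?w = "weight \<zeta> H \<theta> n \<beta>"
  have supp: "set_pmf ?p \<inter> ?S = {?G0, ?G1}"
    unfolding set_pmf_ergm by (rule graphs_agree_off_edge[OF G e])
  then have ne: "set_pmf ?p \<inter> ?S \<noteq> {}" by blast
  have diff: "?G0 \<noteq> ?G1" by (metis put_at zero_neq_one)
  have mem: "?G0 \<in> ?S" "?G1 \<in> ?S" using supp by blast+
  have graph: "?G0 \<in> graphs n" "?G1 \<in> graphs n" using put_graph[OF G e] by auto
  have "measure_pmf.prob ?p ?S = measure_pmf.prob ?p (set_pmf ?p \<inter> ?S)"
    by (simp only: Int_commute[of "set_pmf ?p"] measure_Int_set_pmf)
  also have "\<dots> = measure_pmf.prob ?p {?G0, ?G1}"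
    by (simp only: supp)
  also have "\<dots> = pmf ?p ?G0 + pmf ?p ?G1"
    using diff by (simp add: measure_measure_pmf_finite)
  finally have prob: "measure_pmf.prob ?p ?S = (?w ?G0 + ?w ?G1) / Z \<zeta> H \<theta> n \<beta>"
    using graph by (simp add: pmf_ergm add_divide_distrib)
  have "edge_cond_exp \<zeta> H \<theta> n \<beta> e G
      = (\<Sum>G' \<in> {?G0, ?G1}. case_prod G' e * pmf (cond_pmf ?p ?S) G')"
    unfolding edge_cond_exp_def
    by (rule integral_measure_pmf_real) (use supp set_cond_pmf[OF ne] in auto)
  \<comment> \<open>The graph without the edge contributes the value 0.\<close>
  also have "\<dots> = pmf (cond_pmf ?p ?S) ?G1" using diff by simp
  also have "\<dots> = ?w ?G1 / Z \<zeta> H \<theta> n \<beta> / ((?w ?G0 + ?w ?G1) / Z \<zeta> H \<theta> n \<beta>)"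
    using mem graph by (simp add: pmf_cond[OF ne] prob pmf_ergm)
  also have "\<dots> = ?w ?G1 / (?w ?G1 + ?w ?G0)"
    using Z_pos[of \<zeta> H \<theta> n \<beta>] by (simp add: add.commute)
  finally show ?thesis by (simp add: edge_prob_eq_weight[OF e])
qed

text \<open>Detailed balance for resampling \<open>e\<close>: with weights \<open>w1\<close> and
  \<open>w0\<close> for the edge present and absent, the two sides are
  \<open>w1 * w0 / (w1 + w0)\<close> up to opposite signs. This is the balance hypothesis of
  \<open>second_moment_balanced\<close>.\<close>

lemma weight_flip_balance:
  assumes G: "G \<in> graphs n" and e: "e \<in> pairs n"
  shows "weight \<zeta> H \<theta> n \<beta> (flip e G) *
           (case_prod (flip e G) e - edge_prob \<zeta> H \<theta> n \<beta> e (flip e G))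
         = - (weight \<zeta> H \<theta> n \<beta> G * (case_prod G e - edge_prob \<zeta> H \<theta> n \<beta> e G))"
proof -
  define w0 w1 where "w0 = weight \<zeta> H \<theta> n \<beta> (put e 0 G)" and "w1 = weight \<zeta> H \<theta> n \<beta> (put e 1 G)"
  have pos: "w0 > 0" "w1 > 0" by (auto simp: w0_def w1_def weight_pos)
  have p: "edge_prob \<zeta> H \<theta> n \<beta> e G = w1 / (w1 + w0)"
    unfolding w0_def w1_def by (rule edge_prob_eq_weight[OF e])
  have "case_prod G e = 0 \<or> case_prod G e = 1" using graph_entry[OF G] by (cases e) auto
  then show ?thesis
  proof
    assume b: "case_prod G e = 0"
    then have "weight \<zeta> H \<theta> n \<beta> G = w0" by (simp add: w0_def put_same[OF G b])
    then show ?thesis using b pos by (simp add: flip_def edge_prob_put p w1_def[symmetric] field_simps)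
  next
    assume b: "case_prod G e = 1"
    then have "weight \<zeta> H \<theta> n \<beta> G = w1" by (simp add: w1_def put_same[OF G b])
    then show ?thesis using b pos by (simp add: flip_def edge_prob_put p w0_def[symmetric] field_simps)
  qed
qed

text \<open>The logistic function is 1-Lipschitz, and the scaling of \<theta> cancels the power of
  \<open>n\<close> in \<open>edge_incr_change\<close>.\<close>

lemma edge_prob_change:
  assumes G: "G \<in> graphs n" and e: "e \<in> pairs n" and \<theta>: "\<theta> > 0"
  shows "(\<Sum>f \<in> pairs n. \<bar>edge_prob \<zeta> H \<theta> n \<beta> f (flip e G) - edge_prob \<zeta> H \<theta> n \<beta> f G\<bar>)
           \<le> 4 * \<theta> * (real (card (edges \<zeta> H)))\<^sup>2"
proof -
  let ?r = "\<theta> / real n ^ (\<zeta> - 2)"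
  have n: "n > 0" using e by (auto simp: pairs_def)
  have "(\<Sum>f \<in> pairs n. \<bar>edge_prob \<zeta> H \<theta> n \<beta> f (flip e G) - edge_prob \<zeta> H \<theta> n \<beta> f G\<bar>)
      \<le> (\<Sum>f \<in> pairs n. ?r * \<bar>edge_incr \<zeta> H n f (flip e G) - edge_incr \<zeta> H n f G\<bar>)"
  proof (rule sum_mono)
    fix f
    let ?x = "\<lambda>G. ?r * edge_incr \<zeta> H n f G + \<beta> (fst f) + \<beta> (snd f)"
    have "\<bar>edge_prob \<zeta> H \<theta> n \<beta> f (flip e G) - edge_prob \<zeta> H \<theta> n \<beta> f G\<bar> \<le> \<bar>?x (flip e G) - ?x G\<bar>"
      unfolding edge_prob_def by (rule logistic_lipschitz)
    \<comment> \<open>The \<beta> terms cancel here, which makes every later bound uniform in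
      \<beta>.\<close>
    also have "?x (flip e G) - ?x G = ?r * (edge_incr \<zeta> H n f (flip e G) - edge_incr \<zeta> H n f G)"
      by (simp add: algebra_simps)
    also have "\<bar>\<dots>\<bar> = ?r * \<bar>edge_incr \<zeta> H n f (flip e G) - edge_incr \<zeta> H n f G\<bar>"
      using \<theta> by (simp add: abs_mult)
    finally show "\<bar>edge_prob \<zeta> H \<theta> n \<beta> f (flip e G) - edge_prob \<zeta> H \<theta> n \<beta> f G\<bar>
        \<le> ?r * \<bar>edge_incr \<zeta> H n f (flip e G) - edge_incr \<zeta> H n f G\<bar>" .
  qed
  also have "\<dots> = ?r * (\<Sum>f \<in> pairs n. \<bar>edge_incr \<zeta> H n f (flip e G) - edge_incr \<zeta> H n f G\<bar>)"
    by (simp add: sum_distrib_left)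
  also have "\<dots> \<le> ?r * (4 * (real (card (edges \<zeta> H)))\<^sup>2 * real n ^ (\<zeta> - 2))"
    using \<theta> by (intro mult_left_mono edge_incr_change G e) simp
  also have "\<dots> = 4 * \<theta> * (real (card (edges \<zeta> H)))\<^sup>2" using n by simp
  finally show ?thesis .
qed

section \<open>Concentration of the centred sum\<close>

definition centred_sum ::
  "nat \<Rightarrow> adj \<Rightarrow> real \<Rightarrow> nat \<Rightarrow> (nat \<Rightarrow> real) \<Rightarrow> adj \<Rightarrow> real" where
  "centred_sum \<zeta> H \<theta> n \<beta> G = (\<Sum>e \<in> pairs n. case_prod G e - edge_prob \<zeta> H \<theta> n \<beta> e G)"

text \<open>Centring and sampling use the same \<beta>, so the flips satisfy the balance condition.
  The factor \<open>n\<^sup>2\<close> comes from the number of pairs, and the constant is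
  \<open>1 + K / 2\<close> with \<open>K\<close> from \<open>edge_prob_change\<close>.\<close>

lemma centred_sum_concentration:
  fixes \<theta> :: real
  assumes \<theta>: "\<theta> > 0" and a: "a > 0"
  shows "measure_pmf.prob (ergm \<zeta> H \<theta> n \<beta>) {G. \<bar>centred_sum \<zeta> H \<theta> n \<beta> G\<bar> \<ge> a}
           \<le> (1 + 2 * \<theta> * (real (card (edges \<zeta> H)))\<^sup>2) * (real n / a)\<^sup>2"
proof -
  let ?p = "ergm \<zeta> H \<theta> n \<beta>" and ?K = "4 * \<theta> * (real (card (edges \<zeta> H)))\<^sup>2"
  let ?D = "\<lambda>e G. case_prod G e - edge_prob \<zeta> H \<theta> n \<beta> e G"
  have "(\<Sum>G \<in> graphs n. pmf ?p G * (\<Sum>e \<in> pairs n. ?D e G)\<^sup>2) \<le> real (card (pairs n)) * (1 + ?K / 2)"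
  proof (rule second_moment_balanced[where \<phi> = flip and w = "pmf ?p" and D = ?D, OF finite_pairs])
    show "sum (pmf ?p) (graphs n) = 1"
      by (rule sum_pmf_eq_1[OF finite_graphs]) (simp add: set_pmf_ergm)
  next
    fix e G assume e: "e \<in> pairs n" and G: "G \<in> graphs n"
    show "flip e G \<in> graphs n" by (rule flip_graph[OF G e])
    show "flip e (flip e G) = G" by (rule flip_flip[OF G])
    show "pmf ?p (flip e G) * ?D e (flip e G) = - (pmf ?p G * ?D e G)"
      using weight_flip_balance[OF G e, of \<zeta> H \<theta> \<beta>] flip_graph[OF G e] G
      by (simp add: pmf_ergm)
    have "case_prod G e = 0 \<or> case_prod G e = 1" using graph_entry[OF G] by (cases e) auto
    then show "\<bar>?D e G\<bar> \<le> 1"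
      using edge_prob_bounds[of \<zeta> H \<theta> n \<beta> e G] by auto
    \<comment> \<open>For \<open>f\<close> other than \<open>e\<close> the entry of \<open>G\<close>
      is untouched by the flip, so only the conditional probability moves.\<close>
    have "(\<Sum>f \<in> pairs n - {e}. \<bar>?D f (flip e G) - ?D f G\<bar>)
        = (\<Sum>f \<in> pairs n - {e}. \<bar>edge_prob \<zeta> H \<theta> n \<beta> f (flip e G) - edge_prob \<zeta> H \<theta> n \<beta> f G\<bar>)"
      by (intro sum.cong refl) (simp add: flip_def put_other[OF e] abs_minus_commute)
    also have "\<dots> \<le> (\<Sum>f \<in> pairs n. \<bar>edge_prob \<zeta> H \<theta> n \<beta> f (flip e G) - edge_prob \<zeta> H \<theta> n \<beta> f G\<bar>)"
      by (intro sum_mono2 finite_pairs) auto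
    also have "\<dots> \<le> ?K" by (rule edge_prob_change[OF G e \<theta>])
    finally show "(\<Sum>f \<in> pairs n - {e}. \<bar>?D f (flip e G) - ?D f G\<bar>) \<le> ?K" .
  qed simp
  then have "(\<Sum>G \<in> set_pmf ?p. pmf ?p G * (centred_sum \<zeta> H \<theta> n \<beta> G)\<^sup>2)
      \<le> real (card (pairs n)) * (1 + ?K / 2)"
    by (simp add: set_pmf_ergm centred_sum_def)
  also have "\<dots> \<le> (real n)\<^sup>2 * (1 + ?K / 2)"
    using \<theta> card_pairs_le[of n] by (intro mult_right_mono) (auto simp flip: of_nat_power)
  finally have "measure_pmf.prob ?p {G. \<bar>centred_sum \<zeta> H \<theta> n \<beta> G\<bar> \<ge> a}
      \<le> (real n)\<^sup>2 * (1 + ?K / 2) / a\<^sup>2"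
    by (intro prob_abs_ge_le_second_moment a) (auto simp: set_pmf_ergm finite_graphs)
  then show ?thesis by (simp add: power_divide mult_ac)
qed

lemma sum_deg_test_eq:
  assumes "G \<in> graphs n"
  shows "sum_deg_test \<zeta> H \<theta> \<beta>\<^sub>0 n l G = (if centred_sum \<zeta> H \<theta> n (\<lambda>_. \<beta>\<^sub>0) G > l then 1 else 0)"
proof -
  have "(\<Sum>e \<in> pairs n. case_prod G e - edge_cond_exp \<zeta> H \<theta> n (\<lambda>_. \<beta>\<^sub>0) e G)
      = centred_sum \<zeta> H \<theta> n (\<lambda>_. \<beta>\<^sub>0) G"
    unfolding centred_sum_def by (intro sum.cong refl) (simp add: edge_cond_exp_eq[OF assms])
  then show ?thesis by (simp add: sum_deg_test_def)
qed

section \<open>The drift under the alternative\<close>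

text \<open>Each vertex lies in \<open>n - 1\<close> pairs: the pairs and their mirror images tile
  the square without its diagonal.\<close>

lemma sum_pairs_sym:
  fixes f :: "nat \<Rightarrow> real"
  shows "(\<Sum>e \<in> pairs n. f (fst e) + f (snd e)) = (real n - 1) * (\<Sum>i = 1..n. f i)"
proof -
  have "prod.swap ` pairs n = {(i, j). (j, i) \<in> pairs n}" by force
  then have off: "{1..n} \<times> {1..n} - (\<lambda>i. (i, i)) ` {1..n} = pairs n \<union> prod.swap ` pairs n"
    by (auto simp: pairs_def)
  have "(\<Sum>e \<in> pairs n. f (fst e) + f (snd e))
      = (\<Sum>e \<in> pairs n. f (fst e)) + (\<Sum>e \<in> prod.swap ` pairs n. f (fst e))"
    by (simp add: sum.distrib sum.reindex)
  also have "\<dots> = (\<Sum>e \<in> pairs n \<union> prod.swap ` pairs n. f (fst e))"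
    by (intro sum.union_disjoint[symmetric]) (auto simp: finite_pairs, auto simp: pairs_def)
  also have "\<dots> = (\<Sum>e \<in> {1..n} \<times> {1..n}. f (fst e)) - (\<Sum>e \<in> (\<lambda>i. (i, i)) ` {1..n}. f (fst e))"
    unfolding off[symmetric] by (intro sum_diff) auto
  also have "(\<Sum>e \<in> {1..n} \<times> {1..n}. f (fst e)) = real n * (\<Sum>i = 1..n. f i)"
    by (simp add: sum.cartesian_product[symmetric, of "\<lambda>i j. f i", unfolded case_prod_unfold] sum_distrib_left)
  also have "(\<Sum>e \<in> (\<lambda>i. (i, i)) ` {1..n}. f (fst e)) = (\<Sum>i = 1..n. f i)"
    by (subst sum.reindex) (auto simp: inj_on_def)
  finally show ?thesis by (simp add: algebra_simps)
qed

text \<open>The observed edges cancel in the difference, leaving a sum of gains in edge probability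
  that is bounded below for every graph. \<open>M\<close> bounds the null log-odds, and
  \<open>min A 1\<close> reflects the saturation of the logistic function for large signals.\<close>

lemma centred_sum_drift:
  fixes \<theta> \<beta>\<^sub>0 A :: real and \<zeta> :: nat and H :: adj
  defines "M \<equiv> 2 * \<bar>\<beta>\<^sub>0\<bar> + 2 * \<theta> * real (card (edges \<zeta> H))"
  assumes \<theta>: "\<theta> > 0" and G: "G \<in> graphs n" and n: "n \<ge> 2" and A: "A > 0"
    and \<beta>: "\<beta> \<in> \<Xi> n \<beta>\<^sub>0 s A"
  shows "centred_sum \<zeta> H \<theta> n (\<lambda>_. \<beta>\<^sub>0) G - centred_sum \<zeta> H \<theta> n \<beta> G
           \<ge> exp (- M - 1) / (1 + exp M)\<^sup>2 / 4 * (real n * real s * min A 1)"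
proof -
  define c where "c = exp (- M - 1) / (1 + exp M)\<^sup>2"
  have c: "c > 0" unfolding c_def by (intro divide_pos_pos zero_less_power add_pos_pos) auto
  obtain \<mu> where \<mu>: "\<beta> = (\<lambda>i. \<beta>\<^sub>0 + \<mu> i)" "card (supp n \<mu>) \<ge> s" "\<forall>i \<in> supp n \<mu>. \<mu> i \<ge> A"
    using \<beta> unfolding \<Xi>_def by blast
  define U where "U i = (if i \<in> supp n \<mu> then 1 else 0 :: real)" for i
  have \<mu>_ge: "\<mu> i \<ge> min A 1 * U i" if "i \<in> {1..n}" for i
    using \<mu>(3) that by (auto simp: U_def supp_def)
  have gain: "edge_prob \<zeta> H \<theta> n \<beta> e G - edge_prob \<zeta> H \<theta> n (\<lambda>_. \<beta>\<^sub>0) e G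
      \<ge> c * min A 1 / 2 * (U (fst e) + U (snd e))" if e: "e \<in> pairs n" for e
  proof -
    let ?t = "\<theta> / real n ^ (\<zeta> - 2) * edge_incr \<zeta> H n e G"
    \<comment> \<open>Halving keeps the step at most 1 even when both endpoints lie in the support,
      as \<open>logistic_diff_ge\<close> requires.\<close>
    let ?d = "min A 1 / 2 * (U (fst e) + U (snd e))"
    have ij: "fst e \<in> {1..n}" "snd e \<in> {1..n}" using e by (auto simp: pairs_def)
    have U: "0 \<le> U i" "U i \<le> 1" for i by (auto simp: U_def)
    have "\<bar>?t\<bar> = \<theta> / real n ^ (\<zeta> - 2) * \<bar>edge_incr \<zeta> H n e G\<bar>" using \<theta> by (simp add: abs_mult)
    also have "\<dots> \<le> \<theta> / real n ^ (\<zeta> - 2) * (2 * real (card (edges \<zeta> H)) * real n ^ (\<zeta> - 2))"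
      using \<theta> by (intro mult_left_mono edge_incr_bound G e) simp
    also have "\<dots> = 2 * \<theta> * real (card (edges \<zeta> H))" using n by simp
    finally have x: "\<bar>?t + \<beta>\<^sub>0 + \<beta>\<^sub>0\<bar> \<le> M" unfolding M_def by linarith
    have d0: "0 \<le> ?d" using A U by (intro mult_nonneg_nonneg add_nonneg_nonneg) auto
    have "?d \<le> 1 / 2 * (1 + 1)" using A U by (intro mult_mono add_mono add_nonneg_nonneg) auto
    then have d1: "?d \<le> 1" by simp
    have "2 * ?d \<le> \<mu> (fst e) + \<mu> (snd e)"
      using \<mu>_ge[OF ij(1)] \<mu>_ge[OF ij(2)] by (simp add: algebra_simps)
    then have y: "?t + \<beta>\<^sub>0 + \<beta>\<^sub>0 + ?d \<le> ?t + \<beta> (fst e) + \<beta> (snd e)"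
      unfolding \<mu>(1) using d0 by linarith
    from logistic_diff_ge[OF x d0 d1 y] show ?thesis
      by (simp add: edge_prob_def c_def)
  qed
  have "(\<Sum>i = 1..n. U i) = real (card (supp n \<mu>))"
    by (simp add: U_def sum.If_cases supp_def Int_def conj_commute)
  then have sumU: "(\<Sum>i = 1..n. U i) \<ge> real s" using \<mu>(2) by simp
  \<comment> \<open>Since \<open>n \<ge> 2\<close>, \<open>n / 2\<close> is at most
    \<open>n - 1\<close>; this second halving gives the factor 4.\<close>
  have "c / 4 * (real n * real s * min A 1) = c * min A 1 / 2 * ((real n / 2) * real s)" by simp
  also have "\<dots> \<le> c * min A 1 / 2 * ((real n - 1) * (\<Sum>i = 1..n. U i))"
    using c A n sumU by (intro mult_left_mono[OF mult_mono]) auto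
  also have "\<dots> = (\<Sum>e \<in> pairs n. c * min A 1 / 2 * (U (fst e) + U (snd e)))"
    unfolding sum_pairs_sym[of U n, symmetric] by (rule sum_distrib_left)
  also have "\<dots> \<le> (\<Sum>e \<in> pairs n. edge_prob \<zeta> H \<theta> n \<beta> e G - edge_prob \<zeta> H \<theta> n (\<lambda>_. \<beta>\<^sub>0) e G)"
    by (intro sum_mono gain)
  also have "\<dots> = centred_sum \<zeta> H \<theta> n (\<lambda>_. \<beta>\<^sub>0) G - centred_sum \<zeta> H \<theta> n \<beta> G"
    by (simp add: centred_sum_def sum_subtractf)
  finally show ?thesis unfolding c_def .
qed

section \<open>Vanishing of both error probabilities\<close>

lemma much_less_eventually_le:
  assumes "a \<lless> b" "c > 0"
  shows "\<forall>\<^sub>F n in sequentially. a n \<le> c * b n"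
proof -
  have "\<forall>\<^sub>F n in sequentially. a n / b n < c"
    using assms unfolding much_less_def by (auto dest: order_tendstoD(2))
  moreover have "\<forall>\<^sub>F n in sequentially. b n > 0" using assms unfolding much_less_def by blast
  ultimately show ?thesis by eventually_elim (simp add: field_simps)
qed

theorem theorem1p3:
  fixes \<zeta> :: nat and H :: adj and \<theta> \<beta>\<^sub>0 :: real
    and s :: "nat \<Rightarrow> nat" and A L :: "nat \<Rightarrow> real"
  assumes zeta: "\<zeta> \<ge> 2" and H: "H \<in> graphs \<zeta>" "connected_graph \<zeta> H" and theta: "\<theta> > 0"
    and sA: "filterlim (\<lambda>n. real (s n) * A n) at_top sequentially"
    and L_lower: "(\<lambda>n. real n) \<lless> L" and L_upper: "L \<lless> (\<lambda>n. real n * real (s n) * A n)"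
    and L_upper': "L \<lless> (\<lambda>n. real n * real (s n))"
  shows "(\<lambda>n. emeasure (ergm \<zeta> H \<theta> n (\<lambda>_. \<beta>\<^sub>0)) {G. sum_deg_test \<zeta> H \<theta> \<beta>\<^sub>0 n (L n) G = 1} +
              (SUP \<beta> \<in> \<Xi> n \<beta>\<^sub>0 (s n) (A n).
                 emeasure (ergm \<zeta> H \<theta> n \<beta>) {G. sum_deg_test \<zeta> H \<theta> \<beta>\<^sub>0 n (L n) G = 0}))
         \<longlonglongrightarrow> 0"
proof (rule tendsto_sandwich[OF _ _ tendsto_const])
  define M where "M = 2 * \<bar>\<beta>\<^sub>0\<bar> + 2 * \<theta> * real (card (edges \<zeta> H))"
  define c where "c = exp (- M - 1) / (1 + exp M)\<^sup>2 / 4"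
  define B where "B n = (1 + 2 * \<theta> * (real (card (edges \<zeta> H)))\<^sup>2) * (real n / L n)\<^sup>2" for n
  have c: "c > 0" unfolding c_def by (intro divide_pos_pos zero_less_power add_pos_pos) auto
  \<comment> \<open>Both kinds of error will be placed inside this tail event, centred at the
    parameter that generates the graph.\<close>
  have conc: "emeasure (ergm \<zeta> H \<theta> n \<beta>) S \<le> ennreal (B n)"
    if "L n > 0" and S: "\<And>G. G \<in> graphs n \<Longrightarrow> G \<in> S \<Longrightarrow> \<bar>centred_sum \<zeta> H \<theta> n \<beta> G\<bar> \<ge> L n" for n \<beta> S
  proof -
    have "emeasure (ergm \<zeta> H \<theta> n \<beta>) S
        \<le> emeasure (ergm \<zeta> H \<theta> n \<beta>) {G. \<bar>centred_sum \<zeta> H \<theta> n \<beta> G\<bar> \<ge> L n}"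
      using S by (intro emeasure_mono_AE) (auto simp: AE_measure_pmf_iff set_pmf_ergm)
    also have "\<dots> \<le> ennreal (B n)"
      unfolding B_def measure_pmf.emeasure_eq_measure
      by (intro ennreal_leI centred_sum_concentration theta that)
    finally show ?thesis .
  qed
  have "B \<longlonglongrightarrow> (1 + 2 * \<theta> * (real (card (edges \<zeta> H)))\<^sup>2) * 0\<^sup>2"
    unfolding B_def using L_lower by (intro tendsto_intros) (simp add: much_less_def)
  then have "(\<lambda>n. ennreal (B n)) \<longlonglongrightarrow> ennreal 0" by (intro tendsto_ennrealI) simp
  from tendsto_add[OF this this] show "(\<lambda>n. ennreal (B n) + ennreal (B n)) \<longlonglongrightarrow> 0" by simp
  have "\<forall>\<^sub>F n in sequentially. real (s n) * A n > 0"
    using sA by (simp add: filterlim_at_top_dense)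
  moreover have "\<forall>\<^sub>F n in sequentially. L n > 0" using L_lower by (simp add: much_less_def)
  \<comment> \<open>The factor \<open>c / 2\<close> makes the drift at least \<open>2 * L n\<close>:
    one \<open>L n\<close> pays for the threshold, the other remains as the deviation.\<close>
  moreover have "\<forall>\<^sub>F n in sequentially. L n \<le> c / 2 * (real n * real (s n) * A n)"
    using c by (intro much_less_eventually_le L_upper) simp
  moreover have "\<forall>\<^sub>F n in sequentially. L n \<le> c / 2 * (real n * real (s n))"
    using c by (intro much_less_eventually_le L_upper') simp
  ultimately show "\<forall>\<^sub>F n in sequentially.
      emeasure (ergm \<zeta> H \<theta> n (\<lambda>_. \<beta>\<^sub>0)) {G. sum_deg_test \<zeta> H \<theta> \<beta>\<^sub>0 n (L n) G = 1} +
        (SUP \<beta> \<in> \<Xi> n \<beta>\<^sub>0 (s n) (A n).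
           emeasure (ergm \<zeta> H \<theta> n \<beta>) {G. sum_deg_test \<zeta> H \<theta> \<beta>\<^sub>0 n (L n) G = 0})
      \<le> ennreal (B n) + ennreal (B n)"
    using eventually_ge_at_top[of 2]
  proof eventually_elim
    case (elim n)
    have A: "A n > 0" using elim(1) by (simp add: zero_less_mult_iff)
    \<comment> \<open>\<open>L_upper\<close> handles \<open>A n \<le> 1\<close>, and
      \<open>L_upper'\<close> handles larger signals, where the drift no longer grows with
      \<open>A n\<close>.\<close>
    have L: "2 * L n \<le> c * (real n * real (s n) * min (A n) 1)"
      using elim(3,4) by (cases "A n \<le> 1") (auto simp: min_def)
    show ?case
    \<comment> \<open>\<open>B n\<close> does not depend on \<beta>, so the bound passes to the
      supremum; an empty alternative gives supremum 0.\<close>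
    proof (intro add_mono SUP_least conc elim(2))
      fix G assume "G \<in> graphs n" "G \<in> {G. sum_deg_test \<zeta> H \<theta> \<beta>\<^sub>0 n (L n) G = 1}"
      then show "\<bar>centred_sum \<zeta> H \<theta> n (\<lambda>_. \<beta>\<^sub>0) G\<bar> \<ge> L n"
        by (auto simp: sum_deg_test_eq split: if_splits)
    next
      fix \<beta> G assume \<beta>: "\<beta> \<in> \<Xi> n \<beta>\<^sub>0 (s n) (A n)" and G: "G \<in> graphs n"
        and "G \<in> {G. sum_deg_test \<zeta> H \<theta> \<beta>\<^sub>0 n (L n) G = 0}"
      then have "centred_sum \<zeta> H \<theta> n (\<lambda>_. \<beta>\<^sub>0) G \<le> L n"
        by (auto simp: sum_deg_test_eq split: if_splits)
      moreover have "centred_sum \<zeta> H \<theta> n (\<lambda>_. \<beta>\<^sub>0) G - centred_sum \<zeta> H \<theta> n \<beta> G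
          \<ge> c * (real n * real (s n) * min (A n) 1)"
        unfolding c_def M_def by (rule centred_sum_drift[OF theta G elim(5) A \<beta>])
      \<comment> \<open>Failure to reject forces the correctly centred sum down to at most
        \<open>L n - 2 * L n\<close>.\<close>
      ultimately show "\<bar>centred_sum \<zeta> H \<theta> n \<beta> G\<bar> \<ge> L n" using L by linarith
    qed
  qed
qed simp

end
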